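(* Let $X$ be a compact space and let $\lambda$ be an (infinite) regular cardinal such that $X \in \Gamma(\lambda)$ and moreover $$\lambda = \lambda^{<\,\widehat{c}(X)} < \pi(X).$$ Then $\lambda \in dd(X)$, i.e. there is a dense subspace $D$ of $X$ with $d(D) = \lambda$.
   Context: Compact spaces are assumed Hausdorff. For a topological space $X$, $d(X)$ denotes its density (the least cardinality of a dense subset), and $\pi(X)$ its $\pi$-weight (the least cardinality of a $\pi$-base, i.e. of a family of non-empty open sets such that every non-empty open set contains a member of the family). The double density spectrum of $X$ is $dd(X) = \{d(D) : D \text{ is a dense subspace of } X\}$. The cardinal $\widehat{c}(X)$ is the smallest cardinal $\kappa$ for which there is no family of $\kappa$ many pairwise disjoint non-empty open sets in $X$. As usual, $\lambda^{<\kappa} = \sup\{\lambda^{\mu} : \mu < \kappa,\ \mu \text{ a cardinal}\}$. A $G_\lambda$-set is an intersection of at most $\lambda$ many open sets. For an infinite cardinal $\lambda$, $\Gamma(\lambda)$ is the class of all spaces in which every closed $G_\lambda$-set (as a subspace) has density $\le \lambda$. *)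

theory Defs
  imports "HOL-Analysis.T1_Spaces" "HOL-Analysis.FSigma"
begin

unbundle cardinal_syntax

text \<open>
  Cardinals are represented by cardinal orders and compared up to \<open>=o\<close>, also across different
  types. A cardinal function defined as the least cardinality of an object with property \<open>P\<close> is the
  cardinality of a chosen object of least cardinality; the lemma \<open>least_card\<close> shows that this is
  meaningful as soon as \<open>P\<close> is satisfiable.
\<close>

definition least_card :: "('a set \<Rightarrow> bool) \<Rightarrow> 'a rel" where
  "least_card P = |SOME A. P A \<and> (\<forall>B. P B \<longrightarrow> |A| \<le>o |B| )|"

lemma least_card:
  assumes "P A"
  shows "\<exists>B. P B \<and> least_card P = |B| \<and> (\<forall>C. P C \<longrightarrow> |B| \<le>o |C| )"
proof -
  let ?R = "{ |B| | B. P B}"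
  have "?R \<noteq> {}" "\<forall>r \<in> ?R. Well_order r"
    using assms by (auto simp: card_of_Well_order)
  then obtain r where "r \<in> ?R" "\<forall>r' \<in> ?R. r \<le>o r'"
    using exists_minim_Well_order[of ?R] by auto
  then have "\<exists>B. P B \<and> (\<forall>C. P C \<longrightarrow> |B| \<le>o |C| )"
    by blast
  from someI_ex[OF this] show ?thesis
    unfolding least_card_def by blast
qed

definition dense_subset :: "'a topology \<Rightarrow> 'a set \<Rightarrow> bool" where
  "dense_subset X D \<longleftrightarrow> D \<subseteq> topspace X \<and> X closure_of D = topspace X"

definition dens :: "'a topology \<Rightarrow> 'a rel" where
  "dens X = least_card (dense_subset X)"

lemma dense_subset_topspace: "dense_subset X (topspace X)"
  by (simp add: dense_subset_def)

definition pi_base :: "'a topology \<Rightarrow> 'a set set \<Rightarrow> bool" where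
  "pi_base X \<B> \<longleftrightarrow>
     (\<forall>B \<in> \<B>. openin X B \<and> B \<noteq> {}) \<and>
     (\<forall>U. openin X U \<and> U \<noteq> {} \<longrightarrow> (\<exists>B \<in> \<B>. B \<subseteq> U))"

definition pi_weight :: "'a topology \<Rightarrow> 'a set rel" where
  "pi_weight X = least_card (pi_base X)"

lemma pi_base_all_open: "pi_base X {U. openin X U \<and> U \<noteq> {}}"
  by (auto simp: pi_base_def)

definition double_density_spectrum :: "'a topology \<Rightarrow> 'a rel set" where
  "double_density_spectrum X = {dens (subtopology X D) | D. dense_subset X D}"

definition cellular_family :: "'a topology \<Rightarrow> 'a set set \<Rightarrow> bool" where
  "cellular_family X \<U> \<longleftrightarrow> (\<forall>U \<in> \<U>. openin X U \<and> U \<noteq> {}) \<and> pairwise disjnt \<U>"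

text \<open>
  In \<open>c_hat\<close> the candidate cardinals are those of the sets \<open>K :: 'a set set\<close>. By the lemma below
  some such \<open>K\<close> satisfies the condition, and all cardinals below that of \<open>K\<close> are cardinals of subsets
  of \<open>K\<close>, so this is the minimum over all cardinals.
\<close>

definition c_hat :: "'a topology \<Rightarrow> 'a set rel" where
  "c_hat X = least_card (\<lambda>K. \<nexists>\<U>. cellular_family X \<U> \<and> |\<U>| =o |K| )"

lemma no_cellular_family_UNIV:
  "\<nexists>\<U>. cellular_family X \<U> \<and> |\<U>| =o |UNIV :: 'a set set|" for X :: "'a topology"
proof
  assume "\<exists>\<U>. cellular_family X \<U> \<and> |\<U>| =o |UNIV :: 'a set set|"
  then obtain \<U> where cell: "cellular_family X \<U>" and card: "|\<U>| =o |UNIV :: 'a set set|"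
    by blast
  have "inj_on (\<lambda>U. SOME x. x \<in> U) \<U>"
  proof (rule inj_onI)
    fix U V
    assume UV: "U \<in> \<U>" "V \<in> \<U>" and eq: "(SOME x. x \<in> U) = (SOME x. x \<in> V)"
    have "(SOME x. x \<in> U) \<in> U" "(SOME x. x \<in> V) \<in> V"
      using UV cell by (auto simp: cellular_family_def some_in_eq)
    then show "U = V"
      using UV eq cell by (metis cellular_family_def disjnt_iff pairwiseD)
  qed
  then have "|\<U>| \<le>o |UNIV :: 'a set|"
    using card_of_ordLeq[of \<U> "UNIV :: 'a set"] by blast
  moreover have "|UNIV :: 'a set| <o |UNIV :: 'a set set|"
    using card_of_Pow[of "UNIV :: 'a set"] by simp
  ultimately show False
    using card not_ordLess_ordIso ordLeq_ordLess_trans by blast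
qed

text \<open>The supremum of a set of cardinals, i.e. its least upper bound among the cardinals.\<close>

definition card_sup :: "'a rel set \<Rightarrow> 'a rel" where
  "card_sup R = least_card (\<lambda>A. \<forall>r \<in> R. r \<le>o |A| )"

lemma card_sup_bounded:
  fixes R :: "'a rel set"
  assumes "\<forall>r \<in> R. Card_order r"
  shows "\<forall>r \<in> R. r \<le>o |UNIV :: 'a set|"
proof
  fix r assume "r \<in> R"
  then have "|Field r| =o r"
    using assms by (intro card_of_Field_ordIso) blast
  then show "r \<le>o |UNIV :: 'a set|"
    by (rule ordIso_ordLeq_trans[OF ordIso_symmetric card_of_mono1[OF subset_UNIV]])
qed

text \<open>
  The cardinals \<open>\<mu> < \<kappa>\<close> are, up to \<open>=o\<close>, the cardinals below \<open>\<kappa>\<close> of sets over the type of \<open>\<kappa>\<close>.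
\<close>

definition weak_cexp :: "'a rel \<Rightarrow> 'b rel \<Rightarrow> ('b \<Rightarrow> 'a) rel" where
  "weak_cexp lam \<kappa> = card_sup { lam ^c |M| | M. |M| <o \<kappa> }"

text \<open>The following generalises \<^const>\<open>gdelta_in\<close>.\<close>

definition G_set_in :: "'b rel \<Rightarrow> 'a topology \<Rightarrow> 'a set \<Rightarrow> bool" where
  "G_set_in lam X = ((\<lambda>\<U>. |\<U>| \<le>o lam) intersection_of openin X) relative_to topspace X"

definition Gamma_class :: "'b rel \<Rightarrow> 'a topology set" where
  "Gamma_class lam =
     {X. \<forall>F. closedin X F \<and> G_set_in lam X F \<longrightarrow> dens (subtopology X F) \<le>o lam}"

end

theory Submission
  imports Defs "HOL-Analysis.Urysohn"
begin

text \<open>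
  The dense set is an increasing union \<open>D\<close> of closed sets \<open>F a\<close>, indexed by \<open>a < \<lambda>\<close>, each of which
  misses a non-empty open set \<open>u a\<close>. As \<open>\<lambda>\<close> is regular, a subset of \<open>D\<close> with fewer than \<open>\<lambda>\<close>
  points lies in a single \<open>F a\<close> and cannot be dense, so \<open>d(D) \<ge> \<lambda>\<close>. Here \<open>F a\<close> consists of the
  points that avoid \<open>u b\<close> for all \<open>b \<ge> a\<close>. If every \<open>u b\<close> is a cozero set, then \<open>F a\<close> is a closed
  \<open>G\<^sub>\<lambda>\<close>-set, so \<open>X \<in> \<Gamma>(\<lambda>)\<close> bounds its density by \<open>\<lambda>\<close>, and \<open>d(D) \<le> \<lambda>\<close> follows.

  The point is to choose the sets \<open>u a\<close> such that \<open>D\<close> is dense. They are built together with an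
  increasing chain of families \<open>P a\<close> of at most \<open>\<lambda>\<close> open sets. Since \<open>\<lambda> < \<pi>(X)\<close>, the family
  \<open>P a\<close> is not a \<open>\<pi>\<close>-base, and \<open>u a\<close> is chosen such that no non-empty member of \<open>P a\<close> is contained
  in the closure of \<open>u a\<close> (\<open>ex_thin_open\<close>). The later families contain \<open>B - cl (u a)\<close> for \<open>B \<in> P a\<close>;
  hence a non-empty member of \<open>P a\<close> is never covered by finitely many of the \<open>u b\<close> with \<open>b \<ge> a\<close>,
  and it even contains a non-empty member of a later family that misses all of these
  (\<open>avoid_finitely_many\<close>). The later families also contain the complements of the closures of
  \<open>\<Union>\<W>\<close>, where \<open>\<W> \<subseteq> P a\<close> has fewer than \<open>\<kappa>\<close> members, \<open>\<kappa>\<close> being the least cardinal that is not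
  the cardinality of a cellular family; by \<open>\<lambda>\<^bsup><\<kappa>\<^esup> = \<lambda>\<close> there are at most \<open>\<lambda>\<close> such \<open>\<W>\<close>.
  Consequently every non-empty open \<open>U\<close> is dense, as far as members of the families can tell, in some
  non-empty member \<open>V\<close> of a family (\<open>ex_dense_trace\<close>). If the closure of \<open>U\<close> missed \<open>D\<close>,
  compactness would yield finitely many sets \<open>u b\<close> covering \<open>U\<close>, although some non-empty member of a
  family contained in \<open>V\<close> misses these sets and meets \<open>U\<close> (\<open>D_dense\<close>).
\<close>

section \<open>Cardinal arithmetic below the cellularity\<close>

lemma least_card_le: "P A \<Longrightarrow> least_card P \<le>o |A|"
  using least_card[of P A] by auto

lemma cexp_le_weak_cexp:
  fixes lam :: "'a rel" and \<kappa> :: "'b rel" and M :: "'b set"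
  assumes "|M| <o \<kappa>"
  shows "lam ^c |M| \<le>o weak_cexp lam \<kappa>"
proof -
  let ?R = "{ lam ^c |M| | M :: 'b set. |M| <o \<kappa> }"
  have "\<forall>r \<in> ?R. Card_order r"
    by (auto simp: Card_order_cexp)
  from card_sup_bounded[OF this] have "\<forall>r \<in> ?R. r \<le>o |UNIV :: ('b \<Rightarrow> 'a) set|" .
  from least_card[of "\<lambda>A. \<forall>r \<in> ?R. r \<le>o |A|", OF this] show ?thesis
    using assms unfolding weak_cexp_def card_sup_def by auto
qed

text \<open>
  Subfamilies of cellular families are cellular, so the cardinalities of cellular families form an
  initial segment of the cardinals.
\<close>

lemma c_hat_strict_bound:
  obtains K where "c_hat X = |K|" "\<And>\<W>. cellular_family X \<W> \<Longrightarrow> |\<W>| <o |K|"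
proof -
  obtain K where K: "c_hat X = |K|" "\<nexists>\<U>. cellular_family X \<U> \<and> |\<U>| =o |K|"
    using least_card[of "\<lambda>K. \<nexists>\<U>. cellular_family X \<U> \<and> |\<U>| =o |K|" UNIV]
      no_cellular_family_UNIV[of X] unfolding c_hat_def by blast
  have "|\<W>| <o |K|" if \<W>: "cellular_family X \<W>" for \<W>
  proof (rule ccontr)
    assume "\<not> |\<W>| <o |K|"
    then have "|K| \<le>o |\<W>|"
      using not_ordLess_iff_ordLeq[OF card_of_Well_order card_of_Well_order] by blast
    then obtain \<V> where "\<V> \<subseteq> \<W>" "|K| =o |\<V>|"
      using iffD1[OF internalize_card_of_ordLeq2] by blast
    moreover from \<open>\<V> \<subseteq> \<W>\<close> \<W> have "cellular_family X \<V>"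
      unfolding cellular_family_def by (meson pairwise_subset subsetD)
    ultimately show False
      using K(2) ordIso_symmetric by blast
  qed
  with K(1) show thesis
    by (rule that)
qed

text \<open>
  Otherwise \<open>K\<close> would have a subset \<open>B\<close> of cardinality \<open>\<lambda>\<close>, and
  \<open>\<lambda> < 2\<^bsup>|B|\<^esup> \<le> \<lambda>\<^bsup>|B|\<^esup> \<le> \<lambda>\<close>.
\<close>

lemma le_if_weak_power_le:
  assumes "Card_order lam" "cinfinite lam"
    and pow: "\<And>M :: 'k set. |M| <o |K| \<Longrightarrow> lam ^c |M| \<le>o lam"
  shows "|K :: 'k set| \<le>o lam"
proof (rule ccontr)
  have lam: "lam =o |Field lam|"
    using assms(1) card_of_Field_ordIso ordIso_symmetric by blast
  assume "\<not> |K| \<le>o lam"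
  then have "lam <o |K|"
    using not_ordLeq_iff_ordLess[OF card_order_on_well_order_on[OF assms(1)] card_of_Well_order]
    by blast
  then have "|Field lam| <o |K|"
    using lam ordIso_ordLess_trans ordIso_symmetric by blast
  then obtain B :: "'k set" where B: "|Field lam| =o |B|" "|B| <o |K|"
    using internalize_card_of_ordLess[of "Field lam" "|K|"] by blast
  have "|B| <o ctwo ^c |B|"
    by (rule ordLess_ctwo_cexp[OF card_of_Card_order])
  also have "ctwo ^c |B| \<le>o lam ^c |B|"
    using assms(1,2) by (intro cexp_mono1 ctwo_ordLeq_Cinfinite card_of_Card_order) auto
  also have "lam ^c |B| \<le>o lam"
    using pow[OF B(2)] .
  also have "lam =o |B|"
    using lam B(1) ordIso_transitive by blast
  finally show False
    using not_ordLess_ordLeq ordLeq_refl card_of_Card_order by blast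
qed

text \<open>
  A set of cardinality below \<open>|K|\<close> is the image of a proper initial segment of the well-order
  \<open>|K|\<close>, so there are only \<open>|K|\<close> domains to consider, and at most \<open>\<lambda>\<close> maps from each of them.
\<close>

lemma card_small_subsets:
  assumes lam: "Card_order lam" "cinfinite lam" and A: "|A| \<le>o lam" and K: "|K :: 'k set| \<le>o lam"
    and pow: "\<And>M :: 'k set. |M| <o |K| \<Longrightarrow> lam ^c |M| \<le>o lam"
  shows "|{W. W \<subseteq> A \<and> |W| <o |K|}| \<le>o lam"
proof -
  define I where "I k = underS ( |K| ) k" for k
  have inf: "infinite (Field lam)"
    using lam(2) by (simp add: cinfinite_def)
  have dom: "\<exists>k\<in>K. \<exists>f\<in>Func (I k) A. W = f ` I k" if W: "W \<subseteq> A" "|W| <o |K|" for W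
  proof -
    obtain k where k: "k \<in> K" "|W| =o Restr ( |K| ) (I k)"
      using W(2) ordLess_iff_ordIso_Restr[OF card_of_Well_order card_of_Well_order, of W K]
      unfolding I_def Field_card_of by blast
    have "wo_rel |K|"
      by (simp add: wo_rel_def card_of_Well_order)
    then have "Field (Restr ( |K| ) (I k)) = I k"
      unfolding I_def
      by (simp add: Field_Restr_ofilter card_of_Well_order wo_rel.underS_ofilter)
    moreover have "Card_order (Restr ( |K| ) (I k))"
      using k(2) Card_order_ordIso2 card_of_Card_order by blast
    ultimately have "|I k| =o Restr ( |K| ) (I k)"
      using card_of_Field_ordIso by metis
    then have "|I k| =o |W|"
      using k(2) ordIso_symmetric ordIso_transitive by blast
    then obtain g where g: "bij_betw g (I k) W"
      using card_of_ordIso by blast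
    define f where "f x = (if x \<in> I k then g x else undefined)" for x
    have "W = f ` I k"
      using g unfolding bij_betw_def f_def by auto
    moreover from this have "f \<in> Func (I k) A"
      using W(1) unfolding Func_def f_def by auto
    ultimately show ?thesis
      using k(1) by blast
  qed
  have "{W. W \<subseteq> A \<and> |W| <o |K|} \<subseteq> (\<Union>k\<in>K. (\<lambda>f. f ` I k) ` Func (I k) A)"
  proof
    fix W assume "W \<in> {W. W \<subseteq> A \<and> |W| <o |K|}"
    then obtain k f where "k \<in> K" "f \<in> Func (I k) A" "W = f ` I k"
      using dom[of W] by auto
    then show "W \<in> (\<Union>k\<in>K. (\<lambda>f. f ` I k) ` Func (I k) A)"
      by (intro UN_I[of k]) auto
  qed
  then have "|{W. W \<subseteq> A \<and> |W| <o |K|}| \<le>o |\<Union>k\<in>K. (\<lambda>f. f ` I k) ` Func (I k) A|"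
    by (rule card_of_mono1)
  also have "|\<Union>k\<in>K. (\<lambda>f. f ` I k) ` Func (I k) A| \<le>o lam"
  proof (rule card_of_UNION_ordLeq_infinite_Field[OF inf lam(1) K], intro ballI)
    fix k assume "k \<in> K"
    have "|(\<lambda>f. f ` I k) ` Func (I k) A| \<le>o |Func (I k) A|"
      by (rule card_of_image)
    also have "|Func (I k) A| = |A| ^c |I k|"
      by (simp add: cexp_def Field_card_of)
    also have "|A| ^c |I k| \<le>o lam ^c |I k|"
      using A by (rule cexp_mono1) (rule card_of_Card_order)
    also have "lam ^c |I k| \<le>o lam"
      using pow card_of_underS[OF card_of_Card_order, of k K] \<open>k \<in> K\<close>
      unfolding I_def Field_card_of by blast
    finally show "|(\<lambda>f. f ` I k) ` Func (I k) A| \<le>o lam" .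
  qed
  finally show ?thesis .
qed

section \<open>Transfinite towers\<close>

lemma (in wo_rel) ex_tower:
  obtains P :: "'a \<Rightarrow> 'b set" where "\<And>a. P a = (\<Union>b\<in>underS a. step (P b))"
proof -
  define H :: "('a \<Rightarrow> 'b set) \<Rightarrow> 'a \<Rightarrow> 'b set"
    where "H h a = (\<Union>b\<in>underS a. step (h b))" for h a
  have "adm_wo H"
    unfolding adm_wo_def H_def by auto
  then have "worec H = H (worec H)"
    by (rule worec_fixpoint)
  then have "worec H a = (\<Union>b\<in>underS a. step (worec H b))" for a
    by (metis H_def)
  then show thesis
    by (rule that)
qed

lemma (in wo_rel) finite_has_maximum:
  assumes "finite I" "I \<noteq> {}" "I \<subseteq> Field r"
  obtains m where "m \<in> I" "\<And>i. i \<in> I \<Longrightarrow> (i, m) \<in> r"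
proof -
  from assms have "\<exists>m\<in>I. \<forall>i\<in>I. (i, m) \<in> r"
  proof (induction I rule: finite_ne_induct)
    case (singleton x)
    then show ?case
      using REFL by (auto simp: refl_on_def)
  next
    case (insert x I)
    then obtain m where m: "m \<in> I" "\<forall>i\<in>I. (i, m) \<in> r"
      by auto
    have x: "(x, x) \<in> r"
      using insert.prems REFL by (auto simp: refl_on_def)
    have "(x, m) \<in> r \<or> (m, x) \<in> r"
      using insert.prems m(1) TOTALS by auto
    then show ?case
    proof
      assume "(x, m) \<in> r"
      with m show ?thesis by auto
    next
      assume "(m, x) \<in> r"
      with m x show ?thesis
        using TRANS by (auto dest: transD)
    qed
  qed
  with that show thesis by blast
qed

section \<open>Topological preliminaries\<close>

lemma G_set_in_iff:
  "G_set_in lam X S \<longleftrightarrow>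
     (\<exists>\<U>. |\<U>| \<le>o lam \<and> (\<forall>U\<in>\<U>. openin X U) \<and> S = topspace X \<inter> \<Inter>\<U>)"
  unfolding G_set_in_def relative_to_def intersection_of_def by auto

lemma G_set_in_INT:
  assumes "Card_order lam" "cinfinite lam" "|I| \<le>o lam" and G: "\<And>i. i \<in> I \<Longrightarrow> G_set_in lam X (S i)"
  shows "G_set_in lam X (topspace X \<inter> (\<Inter>i\<in>I. S i))"
proof -
  obtain \<U> where \<U>: "\<And>i. i \<in> I \<Longrightarrow> |\<U> i| \<le>o lam" "\<And>i U. i \<in> I \<Longrightarrow> U \<in> \<U> i \<Longrightarrow> openin X U"
      "\<And>i. i \<in> I \<Longrightarrow> S i = topspace X \<inter> \<Inter>(\<U> i)"
    using G unfolding G_set_in_iff by metis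
  have "|\<Union>i\<in>I. \<U> i| \<le>o lam"
    using assms(1-3) \<U>(1) by (intro card_of_UNION_ordLeq_infinite_Field) (auto simp: cinfinite_def)
  moreover have "topspace X \<inter> (\<Inter>i\<in>I. S i) = topspace X \<inter> \<Inter>(\<Union>i\<in>I. \<U> i)"
    using \<U>(3) by auto
  ultimately show ?thesis
    unfolding G_set_in_iff using \<U>(2) by blast
qed

lemma dense_subset_subtopology_iff:
  assumes "D \<subseteq> topspace X"
  shows "dense_subset (subtopology X D) E \<longleftrightarrow> E \<subseteq> D \<and> D \<subseteq> X closure_of E"
proof -
  have "topspace (subtopology X D) = D"
    using assms by auto
  then show ?thesis
    unfolding dense_subset_def closure_of_subtopology by (auto simp: Int_absorb1)
qed

text \<open>
  Take a Urysohn function that is \<open>1\<close> at a point of \<open>W\<close> and \<open>0\<close> outside \<open>W\<close>. The set where it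
  exceeds \<open>1/2\<close> has its closure in \<open>W\<close>, and its complement is the intersection of the open sets where
  the function is below \<open>1/2 + 1/(n+1)\<close>.
\<close>

lemma open_shrink_G_complement:
  assumes "compact_space X" "Hausdorff_space X" "openin X W" "W \<noteq> {}" "cinfinite lam" "Card_order lam"
  obtains U where "openin X U" "U \<noteq> {}" "X closure_of U \<subseteq> W" "G_set_in lam X (topspace X - U)"
proof -
  obtain x where x: "x \<in> W" "x \<in> topspace X"
    using assms(3,4) openin_subset by fastforce
  have normal: "normal_space X"
    using assms(1,2) by (simp add: compact_Hausdorff_or_regular_imp_normal_space)
  obtain f where f: "continuous_map X euclideanreal f" "f ` (topspace X - W) \<subseteq> {0}" "f ` {x} \<subseteq> {1}"
    by (rule Urysohn_lemma_alt[OF normal, of "topspace X - W" "{x}" 0 1])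
      (use assms x in \<open>auto simp: closedin_Hausdorff_singleton\<close>)
  define U where "U = {y \<in> topspace X. f y \<in> {1/2<..}}"
  define C where "C = {y \<in> topspace X. f y \<in> {1/2..}}"
  define G where "G n = {y \<in> topspace X. f y \<in> {..<1/2 + 1 / real (Suc n)}}" for n
  have U: "openin X U"
    unfolding U_def by (rule openin_continuous_map_preimage[OF f(1)]) simp
  have "closedin X C"
    unfolding C_def by (rule closedin_continuous_map_preimage[OF f(1)]) simp
  then have "X closure_of U \<subseteq> C"
    by (intro closure_of_minimal) (auto simp: U_def C_def)
  also have "C \<subseteq> W"
    using f(2) unfolding C_def by fastforce
  finally have cl: "X closure_of U \<subseteq> W" .
  have ne: "U \<noteq> {}"
    using x f(3) by (auto simp: U_def)
  have G: "openin X (G n)" for n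
    unfolding G_def by (rule openin_continuous_map_preimage[OF f(1)]) simp
  have "|range G| \<le>o |UNIV :: nat set|"
    by (rule card_of_image)
  also have "|UNIV :: nat set| \<le>o |Field lam|"
    using assms(5) by (simp add: cinfinite_def infinite_iff_card_of_nat)
  also have "|Field lam| =o lam"
    using assms(6) by (rule card_of_Field_ordIso)
  finally have "|range G| \<le>o lam" .
  moreover have "topspace X - U = topspace X \<inter> \<Inter>(range G)"
  proof -
    have "f y \<le> 1/2 \<longleftrightarrow> (\<forall>n. f y < 1/2 + 1 / real (Suc n))" for y
    proof
      assume *: "\<forall>n. f y < 1/2 + 1 / real (Suc n)"
      show "f y \<le> 1/2"
      proof (rule ccontr)
        assume "\<not> f y \<le> 1/2"
        then obtain n where "inverse (real (Suc n)) < f y - 1/2"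
          using reals_Archimedean[of "f y - 1/2"] by auto
        moreover have "f y < 1/2 + inverse (real (Suc n))"
          using * by (simp only: inverse_eq_divide)
        ultimately show False
          by linarith
      qed
    next
      assume "f y \<le> 1/2"
      moreover have "0 < 1 / real (Suc n)" for n
        by simp
      ultimately show "\<forall>n. f y < 1/2 + 1 / real (Suc n)"
        by (metis add.right_neutral add_le_less_mono)
    qed
    then have "y \<in> topspace X - U \<longleftrightarrow> y \<in> topspace X \<inter> \<Inter>(range G)" for y
      unfolding U_def G_def Diff_iff Int_iff INT_iff mem_Collect_eq greaterThan_iff lessThan_iff
      by (meson UNIV_I not_less)
    then show ?thesis
      by blast
  qed
  ultimately have "G_set_in lam X (topspace X - U)"
    unfolding G_set_in_iff using G by blast
  with U ne cl that show thesis by blast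
qed

lemma ex_maximal_disjoint_subfamily:
  obtains \<W> where "\<W> \<subseteq> \<A>" "pairwise disjnt \<W>"
    "\<And>A. A \<in> \<A> \<Longrightarrow> (\<And>B. B \<in> \<W> \<Longrightarrow> disjnt A B) \<Longrightarrow> A \<in> \<W>"
proof -
  let ?F = "{\<W>. \<W> \<subseteq> \<A> \<and> pairwise disjnt \<W>}"
  have "\<Union>\<C> \<in> ?F" if "subset.chain ?F \<C>" for \<C>
  proof -
    have "chain\<^sub>\<subseteq> \<C>" "\<And>\<W>. \<W> \<in> \<C> \<Longrightarrow> \<W> \<subseteq> \<A> \<and> pairwise disjnt \<W>"
      using that unfolding subset.chain_def chain_subset_def psubset_eq by blast+
    then show ?thesis
      using pairwise_chain_Union[of \<C> disjnt] by blast
  qed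
  then obtain \<W> where \<W>: "\<W> \<in> ?F" "\<forall>\<V>\<in>?F. \<W> \<subseteq> \<V> \<longrightarrow> \<V> = \<W>"
    using subset_Zorn'[of ?F] by blast
  have "A \<in> \<W>" if "A \<in> \<A>" "\<And>B. B \<in> \<W> \<Longrightarrow> disjnt A B" for A
  proof -
    have "insert A \<W> \<in> ?F"
      using \<W>(1) that by (auto simp: pairwise_insert disjnt_iff)
    with \<W>(2) show ?thesis by blast
  qed
  with \<W>(1) that show thesis by blast
qed

section \<open>The dense set determined by a tower\<close>

text \<open>
  The stages \<open>P a\<close> play the role of a chain of elementary submodels of length \<open>\<lambda>\<close>. That \<open>P a\<close> is
  not a \<open>\<pi>\<close>-base is witnessed by \<open>u a\<close>, even by its closure: removing the closure from a non-empty
  member of \<open>P a\<close> leaves a set that is open and non-empty, so that the argument can be repeated at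
  later stages. The set \<open>K\<close> only carries a cardinality, that of \<open>c_hat\<close>.
\<close>

locale thin_tower =
  fixes X :: "'a topology" and lam :: "'b rel" and K :: "'a set set"
    and P :: "'b \<Rightarrow> 'a set set" and u :: "'b \<Rightarrow> 'a set"
  assumes compact: "compact_space X" and Hausdorff: "Hausdorff_space X"
    and card: "Card_order lam" and inf: "cinfinite lam" and regular: "regularCard lam"
    and cellular_lt: "cellular_family X \<W> \<Longrightarrow> |\<W>| <o |K|"
    and K_le: "|K| \<le>o lam"
    and P_open: "B \<in> P a \<Longrightarrow> openin X B"
    and P_mono: "(a, b) \<in> lam \<Longrightarrow> P a \<subseteq> P b"
    and u_open: "a \<in> Field lam \<Longrightarrow> openin X (u a)"
    and u_nonempty: "a \<in> Field lam \<Longrightarrow> u a \<noteq> {}"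
    and u_G: "a \<in> Field lam \<Longrightarrow> G_set_in lam X (topspace X - u a)"
    and u_thin: "a \<in> Field lam \<Longrightarrow> B \<in> P a \<Longrightarrow> B \<noteq> {} \<Longrightarrow> \<not> B \<subseteq> X closure_of (u a)"
    and step_u: "(a, b) \<in> lam \<Longrightarrow> a \<noteq> b \<Longrightarrow> B \<in> P a \<Longrightarrow> B - X closure_of (u a) \<in> P b"
    and step_small: "(a, b) \<in> lam \<Longrightarrow> a \<noteq> b \<Longrightarrow> \<W> \<subseteq> P a \<Longrightarrow> |\<W>| <o |K|
      \<Longrightarrow> topspace X - X closure_of (\<Union>\<W>) \<in> P b"
begin

sublocale wo_rel lam
  using card by unfold_locales (rule card_order_on_well_order_on)

lemma infinite_Field: "infinite (Field lam)"
  using inf by (simp add: cinfinite_def)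

lemma ex_above:
  assumes "a \<in> Field lam"
  obtains b where "b \<in> Field lam" "a \<noteq> b" "(a, b) \<in> lam"
  using infinite_Card_order_limit[OF card infinite_Field assms] by blast

lemma small_subset_chain_UN:
  assumes "\<And>a b. (a, b) \<in> lam \<Longrightarrow> Q a \<subseteq> Q b" "\<W> \<subseteq> (\<Union>a\<in>Field lam. Q a)" "|\<W>| <o lam"
  obtains a where "a \<in> Field lam" "\<W> \<subseteq> Q a"
  using regularCard_UNION[OF card regular, of Q \<W>] assms unfolding relChain_def by blast

text \<open>
  Remove the closures of the sets \<open>u i\<close> in increasing order of \<open>i\<close>. Before step \<open>i\<close> the current set
  is a non-empty member of \<open>P i\<close>, hence not contained in \<open>cl (u i)\<close>.
\<close>

lemma avoid_finitely_many:
  assumes "V \<in> P a" "V \<noteq> {}" "finite I"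
    and "(a, c) \<in> lam" "\<And>i. i \<in> I \<Longrightarrow> (a, i) \<in> lam \<and> (i, c) \<in> lam \<and> i \<noteq> c"
  shows "\<exists>B\<in>P c. B \<noteq> {} \<and> B \<subseteq> V \<and> (\<forall>i\<in>I. B \<inter> u i = {})"
  using assms(3-5)
proof (induction "card I" arbitrary: I c)
  case 0
  then have "I = {}"
    by simp
  moreover have "V \<in> P c"
    using 0(3) P_mono assms(1) by blast
  ultimately show ?case
    using assms(2) by blast
next
  case (Suc n)
  have "I \<noteq> {}"
    using Suc.hyps(2) by auto
  moreover have "I \<subseteq> Field lam"
    using Suc.prems(3) by (auto intro: FieldI1)
  ultimately obtain m where m: "m \<in> I" "\<And>i. i \<in> I \<Longrightarrow> (i, m) \<in> lam"
    using finite_has_maximum[OF Suc.prems(1)] by blast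
  have m': "(a, m) \<in> lam" "(m, c) \<in> lam" "m \<noteq> c" "m \<in> Field lam"
    using Suc.prems(3)[OF m(1)] by (auto intro: FieldI1)
  have "n = card (I - {m})"
    using Suc.hyps(2) Suc.prems(1) m(1) by simp
  from Suc.hyps(1)[OF this _ m'(1)] obtain B
    where B: "B \<in> P m" "B \<noteq> {}" "B \<subseteq> V" "\<forall>i\<in>I - {m}. B \<inter> u i = {}"
    using Suc.prems m(2) by auto
  let ?B = "B - X closure_of (u m)"
  have "u m \<subseteq> X closure_of (u m)"
    using u_open[OF m'(4)] by (simp add: closure_of_subset openin_subset)
  then have "\<forall>i\<in>I. ?B \<inter> u i = {}"
    using B(4) by blast
  moreover have "?B \<noteq> {}"
    using u_thin[OF m'(4) B(1,2)] by blast
  moreover have "?B \<in> P c"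
    using step_u[OF m'(2,3) B(1)] .
  moreover have "?B \<subseteq> V"
    using B(3) by blast
  ultimately show ?case
    by (intro bexI[of _ ?B] conjI)
qed

text \<open>
  Let \<open>\<W>\<close> be a maximal disjoint family of members of the tower that miss \<open>U\<close>. It has fewer than
  \<open>\<lambda>\<close> members, so by regularity it lies in one stage, and the exterior \<open>V\<close> of its union
  belongs to a later stage. A member of the tower inside \<open>V\<close> that missed \<open>U\<close> could be added to \<open>\<W>\<close>.
\<close>

lemma ex_dense_trace:
  assumes "openin X U" "U \<noteq> {}"
  shows "\<exists>a\<in>Field lam. \<exists>V\<in>P a. V \<noteq> {} \<and>
    (\<forall>c\<in>Field lam. \<forall>B\<in>P c. B \<noteq> {} \<and> B \<subseteq> V \<longrightarrow> B \<inter> U \<noteq> {})"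
proof -
  let ?A = "{B \<in> (\<Union>a\<in>Field lam. P a). B \<noteq> {} \<and> B \<inter> U = {}}"
  obtain \<W> where \<W>: "\<W> \<subseteq> ?A" "pairwise disjnt \<W>"
    "\<And>B. B \<in> ?A \<Longrightarrow> (\<And>C. C \<in> \<W> \<Longrightarrow> disjnt B C) \<Longrightarrow> B \<in> \<W>"
    using ex_maximal_disjoint_subfamily[of ?A] by blast
  have "\<forall>B\<in>\<W>. openin X B \<and> B \<noteq> {}"
    using \<W>(1) P_open by blast
  then have "cellular_family X \<W>"
    using \<W>(2) unfolding cellular_family_def by blast
  then have small: "|\<W>| <o |K|"
    by (rule cellular_lt)
  then have "|\<W>| <o lam"
    using K_le ordLess_ordLeq_trans by blast
  moreover have "\<W> \<subseteq> (\<Union>a\<in>Field lam. P a)"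
    using \<W>(1) by blast
  ultimately obtain a where a: "a \<in> Field lam" "\<W> \<subseteq> P a"
    using small_subset_chain_UN[of P] P_mono by metis
  obtain b where b: "b \<in> Field lam" "a \<noteq> b" "(a, b) \<in> lam"
    using ex_above[OF a(1)] .
  define V where "V = topspace X - X closure_of (\<Union>\<W>)"
  have V: "V \<in> P b"
    unfolding V_def using step_small[OF b(3,2) a(2) small] .
  have "U \<inter> X closure_of (\<Union>\<W>) = {}"
    using \<W>(1) assms(1) by (subst openin_Int_closure_of_eq_empty) auto
  then have "U \<subseteq> V"
    using openin_subset[OF assms(1)] unfolding V_def by blast
  then have "V \<noteq> {}"
    using assms(2) by blast
  moreover have "B \<inter> U \<noteq> {}" if B: "c \<in> Field lam" "B \<in> P c" "B \<noteq> {}" "B \<subseteq> V" for c B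
  proof
    assume "B \<inter> U = {}"
    have "\<Union>\<W> \<subseteq> X closure_of (\<Union>\<W>)"
      using \<W>(1) P_open openin_subset by (intro closure_of_subset) blast
    then have disj: "disjnt B C" if "C \<in> \<W>" for C
      using B(4) that unfolding V_def disjnt_def by blast
    then have "B \<in> \<W>"
      using \<W>(3) B \<open>B \<inter> U = {}\<close> by blast
    with disj B(3) show False
      by (auto simp: disjnt_def)
  qed
  ultimately show ?thesis
    using V b(1) by blast
qed

definition F :: "'b \<Rightarrow> 'a set" where
  "F a = topspace X - (\<Union>b\<in>above a. u b)"

definition D :: "'a set" where
  "D = (\<Union>a\<in>Field lam. F a)"

lemma above_subset_Field: "above a \<subseteq> Field lam"
  by (auto simp: above_def intro: FieldI2)

lemma F_subset_topspace: "F a \<subseteq> topspace X"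
  by (auto simp: F_def)

lemma D_subset_topspace: "D \<subseteq> topspace X"
  using F_subset_topspace by (auto simp: D_def)

lemma F_mono: "(a, b) \<in> lam \<Longrightarrow> F a \<subseteq> F b"
  using TRANS unfolding F_def above_def by (auto dest: transD)

lemma F_misses_u: "a \<in> Field lam \<Longrightarrow> F a \<inter> u a = {}"
  using REFL unfolding F_def above_def by (auto simp: refl_on_def)

lemma F_closed: "closedin X (F a)"
  unfolding F_def using u_open above_subset_Field
  by (intro closedin_diff closedin_topspace openin_Union) blast

lemma F_G_set: "G_set_in lam X (F a)"
proof -
  have "|above a| \<le>o |Field lam|"
    by (rule card_of_mono1[OF above_subset_Field])
  also have "|Field lam| =o lam"
    using card by (rule card_of_Field_ordIso)
  finally have "G_set_in lam X (topspace X \<inter> (\<Inter>b\<in>above a. topspace X - u b))"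
    using card inf u_G above_subset_Field by (intro G_set_in_INT) auto
  also have "topspace X \<inter> (\<Inter>b\<in>above a. topspace X - u b) = F a"
    by (auto simp: F_def)
  finally show ?thesis .
qed

text \<open>
  Suppose that \<open>D\<close> misses an open set, shrunk to \<open>U\<close> so that its closure is missed too. Starting from
  a stage \<open>a\<close> that contains a set \<open>V\<close> in which \<open>U\<close> is dense as far as the tower can see, finitely
  many \<open>u i\<close> with \<open>i \<ge> a\<close> cover \<open>U\<close> by compactness. But \<open>V\<close> contains a non-empty member of the
  tower that misses these finitely many sets, and it has to meet \<open>U\<close>.
\<close>

lemma D_dense: "dense_subset X D"
proof -
  have "D \<inter> W \<noteq> {}" if W: "openin X W" "W \<noteq> {}" for W
  proof
    assume disj: "D \<inter> W = {}"
    obtain U where U: "openin X U" "U \<noteq> {}" "X closure_of U \<subseteq> W"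
      using open_shrink_G_complement[OF compact Hausdorff W inf card] .
    obtain a V where V: "V \<in> P a" "a \<in> Field lam" "V \<noteq> {}"
      "\<forall>c\<in>Field lam. \<forall>B\<in>P c. B \<noteq> {} \<and> B \<subseteq> V \<longrightarrow> B \<inter> U \<noteq> {}"
      using ex_dense_trace[OF U(1,2)] by blast
    have "X closure_of U \<subseteq> (\<Union>b\<in>above a. u b)"
      using disj U(3) V(2) closure_of_subset_topspace[of X U] unfolding D_def F_def by blast
    moreover have "compactin X (X closure_of U)"
      using compact by (simp add: closedin_compact_space)
    moreover have "\<forall>W\<in>u ` above a. openin X W"
      using u_open above_subset_Field by blast
    ultimately obtain \<F> where \<F>: "finite \<F>" "\<F> \<subseteq> u ` above a" "X closure_of U \<subseteq> \<Union>\<F>"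
      unfolding compactin_def by metis
    from finite_subset_image[OF \<F>(1,2)] obtain I
      where I: "I \<subseteq> above a" "finite I" "\<F> = u ` I"
      by blast
    \<comment> \<open>Including \<open>a\<close> provides a maximum when \<open>I\<close> is empty, and puts \<open>c\<close> above \<open>a\<close>.\<close>
    have "insert a I \<subseteq> Field lam"
      using V(2) I(1) above_subset_Field by blast
    then obtain m where m: "m \<in> insert a I" "\<And>i. i \<in> insert a I \<Longrightarrow> (i, m) \<in> lam"
      using finite_has_maximum[of "insert a I"] I(2) by blast
    obtain c where c: "c \<in> Field lam" "m \<noteq> c" "(m, c) \<in> lam"
      using ex_above m(1) \<open>insert a I \<subseteq> Field lam\<close> by blast
    have below: "(i, c) \<in> lam \<and> i \<noteq> c" if "i \<in> insert a I" for i
      using m(2)[OF that] c(2,3) TRANS ANTISYM by (metis transD antisymD)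
    have "\<exists>B\<in>P c. B \<noteq> {} \<and> B \<subseteq> V \<and> (\<forall>i\<in>I. B \<inter> u i = {})"
      using below I(1) by (intro avoid_finitely_many[OF V(1,3) I(2)]) (auto simp: above_def)
    then obtain B where B: "B \<in> P c" "B \<noteq> {}" "B \<subseteq> V" "\<forall>i\<in>I. B \<inter> u i = {}"
      by blast
    have "U \<subseteq> \<Union>(u ` I)"
      using \<F>(3) I(3) closure_of_subset[OF openin_subset[OF U(1)]] by blast
    with B(4) have "B \<inter> U = {}"
      by blast
    with V(4) c(1) B(1-3) show False
      by blast
  qed
  then have "X closure_of D = topspace X"
    unfolding dense_intersects_open by blast
  with D_subset_topspace show ?thesis
    unfolding dense_subset_def by blast
qed

text \<open>
  The union of dense subsets of the \<open>\<lambda>\<close> many pieces \<open>F a\<close>, which are closed \<open>G\<^sub>\<lambda>\<close>-sets, is dense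
  in \<open>D\<close>.
\<close>

lemma dens_D_le:
  assumes "X \<in> Gamma_class lam"
  shows "dens (subtopology X D) \<le>o lam"
proof -
  have "\<exists>E. E \<subseteq> F a \<and> F a \<subseteq> X closure_of E \<and> |E| \<le>o lam" for a
  proof -
    obtain E where "dense_subset (subtopology X (F a)) E" "dens (subtopology X (F a)) = |E|"
      using least_card[of "dense_subset (subtopology X (F a))", OF dense_subset_topspace]
      unfolding dens_def by blast
    moreover have "dens (subtopology X (F a)) \<le>o lam"
      using assms F_closed F_G_set unfolding Gamma_class_def by blast
    ultimately show ?thesis
      using dense_subset_subtopology_iff[OF F_subset_topspace] by metis
  qed
  then obtain E where E: "\<And>a. E a \<subseteq> F a" "\<And>a. F a \<subseteq> X closure_of (E a)" "\<And>a. |E a| \<le>o lam"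
    by metis
  let ?E = "\<Union>a\<in>Field lam. E a"
  have "F a \<subseteq> X closure_of ?E" if "a \<in> Field lam" for a
    using E(2)[of a] closure_of_mono[of "E a" ?E X] that by blast
  then have "D \<subseteq> X closure_of ?E"
    unfolding D_def by blast
  moreover have "?E \<subseteq> D"
    unfolding D_def using E(1) by blast
  ultimately have "dense_subset (subtopology X D) ?E"
    unfolding dense_subset_subtopology_iff[OF D_subset_topspace] by blast
  then have "dens (subtopology X D) \<le>o |?E|"
    unfolding dens_def by (rule least_card_le)
  also have "|?E| \<le>o lam"
    using E(3) card ordIso_imp_ordLeq[OF card_of_Field_ordIso[OF card]]
    by (intro card_of_UNION_ordLeq_infinite_Field[OF infinite_Field]) auto
  finally show ?thesis .
qed

text \<open>
  By regularity a set of fewer than \<open>\<lambda>\<close> points of \<open>D\<close> lies in a single \<open>F a\<close>. Its closure misses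
  \<open>u a\<close>, whereas \<open>D\<close> meets \<open>u a\<close>.
\<close>

lemma le_dens_D: "lam \<le>o dens (subtopology X D)"
proof -
  obtain E where E: "dense_subset (subtopology X D) E" "dens (subtopology X D) = |E|"
    using least_card[of "dense_subset (subtopology X D)", OF dense_subset_topspace]
    unfolding dens_def by blast
  have "\<not> |E| <o lam"
  proof
    assume "|E| <o lam"
    moreover have sub: "E \<subseteq> D" "D \<subseteq> X closure_of E"
      using E(1) unfolding dense_subset_subtopology_iff[OF D_subset_topspace] by auto
    ultimately obtain a where a: "a \<in> Field lam" "E \<subseteq> F a"
      using small_subset_chain_UN[of F E] F_mono unfolding D_def by metis
    have "X closure_of D = topspace X"
      using D_dense unfolding dense_subset_def by blast
    then have "D \<inter> u a \<noteq> {}"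
      using u_open[OF a(1)] u_nonempty[OF a(1)] unfolding dense_intersects_open by blast
    moreover have "D \<subseteq> F a"
      using sub(2) closure_of_minimal[OF a(2) F_closed] by blast
    ultimately show False
      using F_misses_u[OF a(1)] by blast
  qed
  then show ?thesis
    unfolding E(2) using not_ordLess_iff_ordLeq[OF WELL card_of_Well_order] by blast
qed

end

section \<open>Existence of a tower\<close>

definition stage_step :: "'a topology \<Rightarrow> 'a set set \<Rightarrow> 'a set \<Rightarrow> 'a set set \<Rightarrow> 'a set set" where
  "stage_step X K U \<B> =
     (\<lambda>B. B - X closure_of U) ` \<B> \<union>
     (\<lambda>\<W>. topspace X - X closure_of (\<Union>\<W>)) ` {\<W>. \<W> \<subseteq> \<B> \<and> |\<W>| <o |K|}"

lemma stage_step_open: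
  assumes "\<And>B. B \<in> \<B> \<Longrightarrow> openin X B" "B \<in> stage_step X K U \<B>"
  shows "openin X B"
  using assms unfolding stage_step_def by auto

lemma card_stage_step:
  assumes lam: "Card_order lam" "cinfinite lam" and "|\<B>| \<le>o lam" and K: "|K :: 'a set set| \<le>o lam"
    and pow: "\<And>M :: 'a set set. |M| <o |K| \<Longrightarrow> lam ^c |M| \<le>o lam"
  shows "|stage_step X K U \<B>| \<le>o lam"
  unfolding stage_step_def
proof (rule card_of_Un_ordLeq_infinite_Field[OF _ _ _ lam(1)])
  show "infinite (Field lam)"
    using lam(2) by (simp add: cinfinite_def)
  show "|(\<lambda>B. B - X closure_of U) ` \<B>| \<le>o lam"
    using card_of_image assms(3) by (rule ordLeq_transitive)
  show "|(\<lambda>\<W>. topspace X - X closure_of (\<Union>\<W>)) ` {\<W>. \<W> \<subseteq> \<B> \<and> |\<W>| <o |K|}| \<le>o lam"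
    using card_of_image card_small_subsets[OF lam assms(3) K pow] by (rule ordLeq_transitive)
qed

lemma ex_thin_open:
  assumes "compact_space X" "Hausdorff_space X" "Card_order lam" "cinfinite lam"
    and pi: "lam <o pi_weight X" and \<B>: "|\<B>| \<le>o lam" "\<And>B. B \<in> \<B> \<Longrightarrow> openin X B"
  shows "\<exists>U. openin X U \<and> U \<noteq> {} \<and> G_set_in lam X (topspace X - U) \<and>
    (\<forall>B\<in>\<B>. B \<noteq> {} \<longrightarrow> \<not> B \<subseteq> X closure_of U)"
proof -
  have "\<not> pi_base X (\<B> - {{}})"
  proof
    assume "pi_base X (\<B> - {{}})"
    then have "pi_weight X \<le>o |\<B> - {{}}|"
      unfolding pi_weight_def by (rule least_card_le)
    also have "|\<B> - {{}}| \<le>o |\<B>|"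
      by (rule card_of_mono1) blast
    also have "|\<B>| \<le>o lam"
      by (rule \<B>(1))
    finally show False
      using pi not_ordLess_ordLeq by blast
  qed
  then obtain W where W: "openin X W" "W \<noteq> {}" "\<And>B. B \<in> \<B> \<Longrightarrow> B \<noteq> {} \<Longrightarrow> \<not> B \<subseteq> W"
    using \<B>(2) unfolding pi_base_def by blast
  obtain U where "openin X U" "U \<noteq> {}" "X closure_of U \<subseteq> W" "G_set_in lam X (topspace X - U)"
    using open_shrink_G_complement[OF assms(1,2) W(1,2) assms(4,3)] .
  with W(3) show ?thesis
    by (meson order_trans)
qed

theorem theorem2p5:
  fixes X :: "'a topology" and lam :: "'b rel"
  assumes "compact_space X" and "Hausdorff_space X"
    and "Card_order lam" and "cinfinite lam" and "regularCard lam"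
    and "X \<in> Gamma_class lam"
    and "lam =o weak_cexp lam (c_hat X)"
    and "lam <o pi_weight X"
  shows "\<exists>\<kappa> \<in> double_density_spectrum X. \<kappa> =o lam"
proof -
  interpret wo_rel lam
    using assms(3) by unfold_locales (rule card_order_on_well_order_on)
  obtain K where K: "c_hat X = |K|" "\<And>\<W>. cellular_family X \<W> \<Longrightarrow> |\<W>| <o |K|"
    using c_hat_strict_bound[of X] by blast
  have pow: "lam ^c |M| \<le>o lam" if "|M| <o |K|" for M :: "'a set set"
    using cexp_le_weak_cexp[of M "c_hat X" lam] that K(1) assms(7)
    by (metis ordIso_symmetric ordLeq_ordIso_trans)
  have K_le: "|K| \<le>o lam"
    using le_if_weak_power_le[OF assms(3,4) pow] .
  define thin where "thin \<B> = (SOME U. openin X U \<and> U \<noteq> {} \<and> G_set_in lam X (topspace X - U) \<and>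
    (\<forall>B\<in>\<B>. B \<noteq> {} \<longrightarrow> \<not> B \<subseteq> X closure_of U))" for \<B>
  \<comment> \<open>Collecting the steps from all earlier stages makes the stages increasing, so no case
    distinction between successors and limits is needed.\<close>
  obtain P where P: "\<And>a. P a = (\<Union>b\<in>underS a. stage_step X K (thin (P b)) (P b))"
    using ex_tower[of "\<lambda>\<B>. stage_step X K (thin \<B>) \<B>"] by blast
  have P_open: "\<forall>B\<in>P a. openin X B" for a
  proof (induction a rule: well_order_induct)
    case (1 a)
    show ?case
    proof
      fix B assume "B \<in> P a"
      then obtain b where b: "b \<in> underS a" "B \<in> stage_step X K (thin (P b)) (P b)"
        using P[of a] by blast
      have "\<forall>C\<in>P b. openin X C"
        using 1 b(1) unfolding underS_def by blast
      then show "openin X B"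
        using stage_step_open[OF _ b(2)] by blast
    qed
  qed
  have P_card: "|P a| \<le>o lam" for a
  proof (induction a rule: well_order_induct)
    case (1 a)
    have IH: "|P b| \<le>o lam" if "b \<in> underS a" for b
      using 1 that unfolding underS_def by blast
    have "|underS a| \<le>o |Field lam|"
      by (rule card_of_mono1) (blast intro: underS_Field)
    also have "|Field lam| =o lam"
      using assms(3) by (rule card_of_Field_ordIso)
    finally have small: "|underS a| \<le>o lam" .
    have "infinite (Field lam)"
      using assms(4) by (simp add: cinfinite_def)
    then have "|\<Union>b\<in>underS a. stage_step X K (thin (P b)) (P b)| \<le>o lam"
      using card_stage_step[OF assms(3,4) IH K_le pow]
      by (intro card_of_UNION_ordLeq_infinite_Field[OF _ assms(3) small]) blast+
    then show ?case
      using P[of a] by simp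
  qed
  have thin: "openin X (thin (P a)) \<and> thin (P a) \<noteq> {} \<and>
    G_set_in lam X (topspace X - thin (P a)) \<and>
    (\<forall>B\<in>P a. B \<noteq> {} \<longrightarrow> \<not> B \<subseteq> X closure_of (thin (P a)))" for a
    unfolding thin_def
    by (rule someI_ex[OF ex_thin_open[OF assms(1-4,8) P_card]]) (use P_open in blast)
  have step: "stage_step X K (thin (P a)) (P a) \<subseteq> P b" if "(a, b) \<in> lam" "a \<noteq> b" for a b
    using that P[of b] by (auto simp: underS_def)
  interpret thin_tower X lam K P "\<lambda>a. thin (P a)"
  proof
    show "P a \<subseteq> P b" if "(a, b) \<in> lam" for a b
    proof -
      have "underS a \<subseteq> underS b"
        by (rule underS_incr[OF TRANS ANTISYM that])
      then show ?thesis
        using P[of a] P[of b] by blast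
    qed
    show "B - X closure_of (thin (P a)) \<in> P b"
      if "(a, b) \<in> lam" "a \<noteq> b" "B \<in> P a" for a b B
      using step[OF that(1,2)] that(3) unfolding stage_step_def by blast
    show "topspace X - X closure_of (\<Union>\<W>) \<in> P b"
      if "(a, b) \<in> lam" "a \<noteq> b" "\<W> \<subseteq> P a" "|\<W>| <o |K|" for a b \<W>
      using step[OF that(1,2)] that(3,4) unfolding stage_step_def by blast
    show "openin X B" if "B \<in> P a" for a B
      using P_open[of a] that by blast
    show "\<not> B \<subseteq> X closure_of (thin (P a))" if "B \<in> P a" "B \<noteq> {}" for a B
      using thin[of a] that by blast
  qed (simp_all only: assms(1-5) K(2) K_le thin simp_thms)
  have "dens (subtopology X D) =o lam"
    using dens_D_le[OF assms(6)] le_dens_D by (simp add: ordIso_iff_ordLeq)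
  moreover have "dens (subtopology X D) \<in> double_density_spectrum X"
    using D_dense unfolding double_density_spectrum_def by blast
  ultimately show ?thesis
    by blast
qed

end
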